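(* Let $A\in\{A_1,A_2\}$ and suppose there exist $\varphi_*,\varphi^*\in H$ such that (a) $\varphi_*(u)\le\varphi^*(u)$, $A\varphi^*(u)\le\varphi^*(u)$, $A\varphi_*(u)\ge\varphi_*(u)$ for all $u\ge0$, and (b) $\lim_{u\to+\infty}\varphi_*(u)=\lim_{u\to+\infty}\varphi^*(u)=1$. Suppose further that $F(z)<1$ for all $z\ge0$, or that $G(z)<1$ for all $z\ge0$. Let $\varphi^0\in H$ with $\varphi_*(u)\le\varphi^0(u)\le\varphi^*(u)$ for all $u\ge0$, and let $\varphi^{k+1}=A\varphi^k$, $k=0,1,\dots$. Let $\varphi\in H$ be the solution of the problem $\varphi=A\varphi$, $\lim_{u\to+\infty}\varphi(u)=1$. Then $\varphi^k$ converges to $\varphi$ uniformly and monotonically, i.e. $\rho(\varphi^k,\varphi)$ decreases monotonically to $0$. Moreover, $\varphi^k$ converges to any $\varepsilon$-neighborhood of the solution at the rate of a geometric progression with denominator depending on $\varepsilon$: for every $\varepsilon>0$ there is $q(\varepsilon)\in[0,1)$ such that $\rho(\varphi^k,\varphi)\le(q(\varepsilon))^k\rho(\varphi^0,\varphi)$ for all $k$ such that $\rho(\varphi^k,\varphi)\ge\varepsilon$.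
   Context: $H$ is the set of nondecreasing functions $\varphi:[0,+\infty)\to[0,1]$ with the metric $\rho(\varphi_1,\varphi_2)=\sup_{u\ge0}|\varphi_1(u)-\varphi_2(u)|$. $\alpha_c,\alpha_p>0$ are constants. $F$ and $G$ are distribution functions of nonnegative random variables (claims and premiums). $c:[0,+\infty)\to[0,+\infty)$ is piecewise continuous and $U(u,t)$ is the solution of the Cauchy problem $dU/dt=c(U)$, $U(u,0)=u$, assumed well defined for all $u,t\ge0$; it is nondecreasing in $u$. $K_p,K_c$ are distribution functions of nonnegative random variables with no common discontinuity points and with $K_p(t)<1$, $K_c(t)<1$ for all $t\ge0$. For $u\ge0$, $$A_1\varphi(u)=\frac{\alpha_c}{\alpha_c+\alpha_p}\int_0^u\varphi(u-z)\,dF(z)+\frac{\alpha_p}{\alpha_c+\alpha_p}\int_0^{+\infty}\varphi(u+z)\,dG(z),$$ $$A_2\varphi(u)=\int_0^\infty\!\int_0^{U(u,t)}\varphi(U(u,t)-z)\,dF(z)(1-K_p(t))\,dK_c(t)+\int_0^\infty\!\int_0^{+\infty}\varphi(U(u,t)+z)\,dG(z)(1-K_c(t))\,dK_p(t).$$ Integrals are Lebesgue–Stieltjes integrals with endpoints included. Under the hypotheses of the claim the problem $\varphi=A\varphi$, $\lim_{u\to+\infty}\varphi(u)=1$ has a unique solution in $H$. *)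

theory Defs
  imports "HOL-Probability.Probability"
begin

text \<open>
  Functions on \<open>[0, \<infinity>)\<close> are total functions on the reals of which only the values at nonnegative
  arguments matter; accordingly all (in)equalities between them are asserted on \<open>{0..}\<close> only.
\<close>

definition H :: "(real \<Rightarrow> real) set" where
  "H = {\<phi>. mono_on {0..} \<phi> \<and> (\<forall>u\<ge>0. \<phi> u \<in> {0..1})}"

definition rho :: "(real \<Rightarrow> real) \<Rightarrow> (real \<Rightarrow> real) \<Rightarrow> real" where
  "rho \<phi>1 \<phi>2 = (SUP u\<in>{0..}. \<bar>\<phi>1 u - \<phi>2 u\<bar>)"

text \<open>
  \<open>M\<close> is the law of the random variable. Since \<open>F = cdf M\<close>, the Lebesgue--Stieltjes measure
  \<open>interval_measure F\<close> is \<open>M\<close> itself; in particular it sees an atom at \<open>0\<close>, as \<open>F\<close> vanishes on the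
  negative axis.
\<close>

definition nonneg_distribution_function :: "(real \<Rightarrow> real) \<Rightarrow> bool" where
  "nonneg_distribution_function F \<longleftrightarrow>
     (\<exists>M. real_distribution M \<and> (AE x in M. 0 \<le> x) \<and> F = cdf M)"

definition piecewise_continuous_nonneg :: "(real \<Rightarrow> real) \<Rightarrow> bool" where
  "piecewise_continuous_nonneg c \<longleftrightarrow>
     (\<forall>b. finite {x \<in> {0..b}. \<not> continuous (at x within {0..}) c}) \<and>
     (\<forall>x\<ge>0. \<exists>l. (c \<longlongrightarrow> l) (at_right x)) \<and>
     (\<forall>x>0. \<exists>l. (c \<longlongrightarrow> l) (at_left x))"

text \<open>
  Since \<open>c\<close> may jump, a solution of \<open>dy/dt = c(y)\<close>, \<open>y(0) = u\<close> is a continuous function that satisfies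
  the equation at all times except finitely many in each bounded interval (it may have a corner
  when it crosses a jump of \<open>c\<close>).
\<close>

definition cauchy_solution :: "(real \<Rightarrow> real) \<Rightarrow> real \<Rightarrow> (real \<Rightarrow> real) \<Rightarrow> bool" where
  "cauchy_solution c u y \<longleftrightarrow>
     y 0 = u \<and> (\<forall>t\<ge>0. 0 \<le> y t) \<and> continuous_on {0..} y \<and>
     (\<exists>S. (\<forall>T. finite (S \<inter> {0..T})) \<and>
          (\<forall>t\<in>{0..} - S. (y has_real_derivative c (y t)) (at t within {0..})))"

definition A1 :: "real \<Rightarrow> real \<Rightarrow> (real \<Rightarrow> real) \<Rightarrow> (real \<Rightarrow> real) \<Rightarrow> (real \<Rightarrow> real) \<Rightarrow> real \<Rightarrow> real" where
  "A1 \<alpha>c \<alpha>p F G \<phi> u =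
     \<alpha>c / (\<alpha>c + \<alpha>p) * (LINT z:{0..u}|interval_measure F. \<phi> (u - z)) +
     \<alpha>p / (\<alpha>c + \<alpha>p) * (LINT z:{0..}|interval_measure G. \<phi> (u + z))"

definition A2 :: "(real \<Rightarrow> real) \<Rightarrow> (real \<Rightarrow> real) \<Rightarrow> (real \<Rightarrow> real \<Rightarrow> real) \<Rightarrow> (real \<Rightarrow> real) \<Rightarrow> (real \<Rightarrow> real) \<Rightarrow>
    (real \<Rightarrow> real) \<Rightarrow> real \<Rightarrow> real" where
  "A2 F G U Kp Kc \<phi> u =
     (LINT t:{0..}|interval_measure Kc.
        (LINT z:{0..U u t}|interval_measure F. \<phi> (U u t - z)) * (1 - Kp t)) +
     (LINT t:{0..}|interval_measure Kp.
        (LINT z:{0..}|interval_measure G. \<phi> (U u t + z)) * (1 - Kc t))"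

end

theory Submission
  imports Defs
begin

text \<open>
  Both operators average the function, extended by \<open>0\<close> to the negative axis, first over the
  claim or premium size and then over the time of the next jump, with total weight at most \<open>1\<close>.
  Hence they are monotone on \<open>H\<close> and do not increase \<open>rho\<close>. All iterates lie above \<open>\<phi>low\<close>, so
  they differ from the solution by at most \<open>\<epsilon>/2\<close> on some half line \<open>[L, \<infinity>)\<close>. While the distance is at
  least \<open>\<epsilon>\<close>, one step multiplies it by at most some \<open>q < 1\<close>: if \<open>G < 1\<close>, then from every starting
  point a premium larger than \<open>L\<close> leads into \<open>[L, \<infinity>)\<close> with a probability bounded away from \<open>0\<close>;
  if \<open>F < 1\<close>, then from every point of \<open>[0, L]\<close> a claim causes ruin (where all functions
  agree) with a probability bounded away from \<open>0\<close>, while on \<open>[L, \<infinity>)\<close> the next iterate is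
  already \<open>\<epsilon>/2\<close>-close.
\<close>

section \<open>Comparison of integrals, and laws versus their distribution functions\<close>

lemma abs_integral_diff_le:
  fixes f g h :: "'a \<Rightarrow> real"
  assumes "integrable M f" "integrable M g" "integrable M h"
    and "\<And>x. x \<in> space M \<Longrightarrow> \<bar>f x - g x\<bar> \<le> h x"
  shows "\<bar>integral\<^sup>L M f - integral\<^sup>L M g\<bar> \<le> integral\<^sup>L M h"
proof -
  have "\<bar>integral\<^sup>L M f - integral\<^sup>L M g\<bar> = \<bar>\<integral>x. f x - g x \<partial>M\<bar>"
    using assms by simp
  also have "\<dots> \<le> (\<integral>x. \<bar>f x - g x\<bar> \<partial>M)"
    by (rule integral_abs_bound)
  also have "\<dots> \<le> integral\<^sup>L M h"
    using assms by (intro integral_mono integrable_abs) auto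
  finally show ?thesis .
qed

text \<open>A law on the line is determined by its distribution function. Every Stieltjes integral
  in \<open>A1\<close> and \<open>A2\<close> thereby becomes an integral against the law
  itself.\<close>

lemma interval_measure_cdf:
  assumes "real_distribution M"
  shows "interval_measure (cdf M) = M"
proof -
  interpret real_distribution M by fact
  have "real_distribution (interval_measure (cdf M))"
    by (rule real_distribution_interval_measure)
      (simp_all add: cdf_nondecreasing cdf_is_right_cont cdf_lim_at_bot cdf_lim_at_top_prob)
  moreover have "cdf (interval_measure (cdf M)) = cdf M"
    by (rule cdf_interval_measure) (simp_all add: cdf_nondecreasing cdf_is_right_cont cdf_lim_at_bot)
  ultimately show ?thesis
    using assms cdf_unique by blast
qed

lemma (in real_distribution) measure_greaterThan: "measure M {x<..} = 1 - cdf M x"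
proof -
  have "{x<..} = space M - {..x}"
    by auto
  then show ?thesis
    unfolding cdf_def using prob_compl[of "{..x}"] by simp
qed

lemma (in real_distribution) cdf_measurable [measurable]: "cdf M \<in> borel_measurable borel"
  by (intro borel_measurable_mono monoI cdf_nondecreasing)

text \<open>With independent \<open>X\<close>, \<open>Y\<close> this is \<open>P(Y < X) + P(X < Y) \<le> 1\<close>.\<close>

lemma nn_integral_cdf_swap_le_1:
  assumes "real_distribution M" "real_distribution N"
  shows "(\<integral>\<^sup>+t. ennreal (1 - cdf M t) \<partial>N) + (\<integral>\<^sup>+t. ennreal (1 - cdf N t) \<partial>M) \<le> 1"
proof -
  interpret M: real_distribution M by fact
  interpret N: real_distribution N by fact
  interpret pair_prob_space M N by standard
  let ?A = "{p. snd p < fst p} :: (real \<times> real) set"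
  let ?B = "{p. fst p < snd p} :: (real \<times> real) set"
  have "sets (M \<Otimes>\<^sub>M N) = sets (borel :: (real \<times> real) measure)"
    by (simp add: borel_prod[symmetric] cong: sets_pair_measure_cong)
  then have A: "?A \<in> sets (M \<Otimes>\<^sub>M N)" and B: "?B \<in> sets (M \<Otimes>\<^sub>M N)"
    by (auto intro!: borel_open open_Collect_less continuous_intros)
  \<comment> \<open>Slicing at a fixed value \<open>t\<close> of one coordinate leaves the strict
    tail \<open>{t<..}\<close> of the other. Ties fall into neither event, so the two are
    disjoint.\<close>
  have "(\<integral>\<^sup>+t. ennreal (1 - cdf M t) \<partial>N) = emeasure (M \<Otimes>\<^sub>M N) ?A"
    by (subst emeasure_pair_measure_alt2[OF A])
      (simp add: vimage_def M.measure_greaterThan[symmetric] M.emeasure_eq_measure greaterThan_def)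
  moreover have "(\<integral>\<^sup>+t. ennreal (1 - cdf N t) \<partial>M) = emeasure (M \<Otimes>\<^sub>M N) ?B"
    by (subst N.emeasure_pair_measure_alt[OF B])
      (simp add: vimage_def N.measure_greaterThan[symmetric] N.emeasure_eq_measure greaterThan_def)
  moreover have "emeasure (M \<Otimes>\<^sub>M N) ?A + emeasure (M \<Otimes>\<^sub>M N) ?B = emeasure (M \<Otimes>\<^sub>M N) (?A \<union> ?B)"
    using A B by (intro plus_emeasure) auto
  moreover have "emeasure (M \<Otimes>\<^sub>M N) (?A \<union> ?B) \<le> 1"
    by (rule P.measure_le_1)
  ultimately show ?thesis
    by simp
qed

section \<open>The function space \<open>H\<close>, the metric \<open>rho\<close> and extension by
  zero\<close>

lemma HD:
  assumes "\<phi> \<in> H"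
  shows H_mono: "0 \<le> u \<Longrightarrow> u \<le> v \<Longrightarrow> \<phi> u \<le> \<phi> v"
    and H_nonneg: "0 \<le> u \<Longrightarrow> 0 \<le> \<phi> u"
    and H_le_1: "0 \<le> u \<Longrightarrow> \<phi> u \<le> 1"
  using assms by (auto simp: H_def mono_on_def)

text \<open>Values in \<open>[0,1]\<close> bound the differences, which is what makes the
  real-valued \<open>SUP\<close> in \<open>rho\<close> an actual upper bound.\<close>

lemma abs_diff_le_rho:
  assumes "\<phi> \<in> H" "\<psi> \<in> H" "0 \<le> u"
  shows "\<bar>\<phi> u - \<psi> u\<bar> \<le> rho \<phi> \<psi>"
  unfolding rho_def
proof (rule cSUP_upper)
  have "\<bar>\<phi> v - \<psi> v\<bar> \<le> 1" if "0 \<le> v" for v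
    using H_nonneg[OF assms(1) that] H_le_1[OF assms(1) that]
      H_nonneg[OF assms(2) that] H_le_1[OF assms(2) that] by linarith
  then show "bdd_above ((\<lambda>u. \<bar>\<phi> u - \<psi> u\<bar>) ` {0..})"
    by (intro bdd_aboveI[of _ 1]) auto
qed (use assms in auto)

lemma rho_le: "(\<And>u. 0 \<le> u \<Longrightarrow> \<bar>\<phi> u - \<psi> u\<bar> \<le> r) \<Longrightarrow> rho \<phi> \<psi> \<le> r"
  unfolding rho_def by (rule cSUP_least) auto

lemma rho_nonneg: "\<phi> \<in> H \<Longrightarrow> \<psi> \<in> H \<Longrightarrow> 0 \<le> rho \<phi> \<psi>"
  using abs_diff_le_rho[of \<phi> \<psi> 0] by linarith

text \<open>The value \<open>0\<close> on the negative axis encodes ruin: a claim above the reserve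
  contributes nothing. As members of \<open>H\<close> are nonnegative, the extension is monotone on
  the whole line, hence Borel measurable.\<close>

definition zero_ext :: "(real \<Rightarrow> real) \<Rightarrow> real \<Rightarrow> real" where
  "zero_ext \<phi> x = (if 0 \<le> x then \<phi> x else 0)"

lemma zero_ext_simps [simp]:
  "0 \<le> x \<Longrightarrow> zero_ext \<phi> x = \<phi> x"
  "x < 0 \<Longrightarrow> zero_ext \<phi> x = 0"
  by (simp_all add: zero_ext_def)

lemma zero_ext_mono: "\<phi> \<in> H \<Longrightarrow> x \<le> y \<Longrightarrow> zero_ext \<phi> x \<le> zero_ext \<phi> y"
  using H_mono[of \<phi> x y] H_nonneg[of \<phi> y] by (simp add: zero_ext_def)

lemma zero_ext_bounds:
  assumes "\<phi> \<in> H"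
  shows "0 \<le> zero_ext \<phi> x" "zero_ext \<phi> x \<le> 1" "\<bar>zero_ext \<phi> x\<bar> \<le> 1"
  using H_nonneg[OF assms, of x] H_le_1[OF assms, of x] by (simp_all add: zero_ext_def)

lemma zero_ext_measurable: "\<phi> \<in> H \<Longrightarrow> zero_ext \<phi> \<in> borel_measurable borel"
  by (intro borel_measurable_mono monoI zero_ext_mono)

section \<open>Averages over a single claim or premium\<close>

context real_distribution
begin

definition mean_loss :: "(real \<Rightarrow> real) \<Rightarrow> real \<Rightarrow> real" where
  "mean_loss \<phi> v = (\<integral>z. zero_ext \<phi> (v - z) \<partial>M)"

definition mean_gain :: "(real \<Rightarrow> real) \<Rightarrow> real \<Rightarrow> real" where
  "mean_gain \<phi> v = (\<integral>z. zero_ext \<phi> (v + z) \<partial>M)"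

text \<open>Viewed as a member of \<open>H\<close>, the distribution function falls under the
  integrability results for \<open>H\<close>.\<close>

lemma cdf_in_H: "cdf M \<in> H"
  by (auto simp: H_def mono_on_def cdf_nondecreasing cdf_nonneg cdf_bounded_prob)

lemma integrable_zero_ext:
  assumes "\<phi> \<in> H" and [measurable]: "g \<in> borel_measurable borel"
  shows "integrable M (\<lambda>z. zero_ext \<phi> (g z))"
proof -
  note [measurable] = zero_ext_measurable[OF assms(1)]
  show ?thesis
    by (rule integrable_const_bound[of _ 1]) (auto simp: zero_ext_bounds[OF assms(1)])
qed

lemma integrable_loss: "\<phi> \<in> H \<Longrightarrow> integrable M (\<lambda>z. zero_ext \<phi> (v - z))"
  and integrable_gain: "\<phi> \<in> H \<Longrightarrow> integrable M (\<lambda>z. zero_ext \<phi> (v + z))"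
  by (simp_all add: integrable_zero_ext)

lemma mean_loss_in_H:
  assumes "\<phi> \<in> H"
  shows "mean_loss \<phi> \<in> H"
proof -
  have "mean_loss \<phi> u \<le> mean_loss \<phi> v" if "u \<le> v" for u v
    unfolding mean_loss_def using that
    by (intro integral_mono integrable_loss assms zero_ext_mono) auto
  moreover have "0 \<le> mean_loss \<phi> u" "mean_loss \<phi> u \<le> 1" for u
    unfolding mean_loss_def
    by (auto intro!: Bochner_Integration.integral_nonneg integral_le_const integrable_loss assms simp: zero_ext_bounds[OF assms])
  ultimately show ?thesis
    by (auto simp: H_def mono_on_def)
qed

lemma mean_gain_in_H:
  assumes "\<phi> \<in> H"
  shows "mean_gain \<phi> \<in> H"
proof -
  have "mean_gain \<phi> u \<le> mean_gain \<phi> v" if "u \<le> v" for u v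
    unfolding mean_gain_def using that
    by (intro integral_mono integrable_gain assms zero_ext_mono) auto
  moreover have "0 \<le> mean_gain \<phi> u" "mean_gain \<phi> u \<le> 1" for u
    unfolding mean_gain_def
    by (auto intro!: Bochner_Integration.integral_nonneg integral_le_const integrable_gain assms simp: zero_ext_bounds[OF assms])
  ultimately show ?thesis
    by (auto simp: H_def mono_on_def)
qed

lemma mean_loss_le:
  assumes "\<phi> \<in> H" "\<psi> \<in> H" "\<And>u. 0 \<le> u \<Longrightarrow> \<phi> u \<le> \<psi> u"
  shows "mean_loss \<phi> v \<le> mean_loss \<psi> v"
  unfolding mean_loss_def
  by (intro integral_mono integrable_loss assms) (simp add: zero_ext_def assms)

lemma mean_gain_le:
  assumes "\<phi> \<in> H" "\<psi> \<in> H" "\<And>u. 0 \<le> u \<Longrightarrow> \<phi> u \<le> \<psi> u"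
  shows "mean_gain \<phi> v \<le> mean_gain \<psi> v"
  unfolding mean_gain_def
  by (intro integral_mono integrable_gain assms) (simp add: zero_ext_def assms)

text \<open>For a claim above \<open>v\<close> both extensions vanish, so only claims in
  \<open>{..v}\<close> contribute to the difference.\<close>

lemma mean_loss_diff_le:
  assumes "\<phi> \<in> H" "\<psi> \<in> H" "\<And>u. 0 \<le> u \<Longrightarrow> \<bar>\<phi> u - \<psi> u\<bar> \<le> r"
  shows "\<bar>mean_loss \<phi> v - mean_loss \<psi> v\<bar> \<le> r * cdf M v"
proof -
  have "\<bar>mean_loss \<phi> v - mean_loss \<psi> v\<bar> \<le> (\<integral>z. r * indicator {..v} z \<partial>M)"
    unfolding mean_loss_def
    by (intro abs_integral_diff_le integrable_loss assms integrable_mult_right integrable_real_indicator)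
      (auto simp: zero_ext_def assms indicator_def emeasure_eq_measure)
  then show ?thesis
    by (simp add: cdf_def)
qed

text \<open>Split by premium size: as \<open>0 \<le> v\<close>, a premium above \<open>L\<close>
  leads beyond \<open>L\<close>, where \<open>s\<close> bounds the difference; otherwise
  \<open>r\<close> does.\<close>

lemma mean_gain_diff_le:
  assumes "\<phi> \<in> H" "\<psi> \<in> H" "\<And>u. 0 \<le> u \<Longrightarrow> \<bar>\<phi> u - \<psi> u\<bar> \<le> r"
    and "\<And>u. L \<le> u \<Longrightarrow> \<bar>\<phi> u - \<psi> u\<bar> \<le> s" and "0 \<le> r" "0 \<le> v" "0 \<le> L"
  shows "\<bar>mean_gain \<phi> v - mean_gain \<psi> v\<bar> \<le> r * cdf M L + s * (1 - cdf M L)"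
proof -
  have int: "integrable M (\<lambda>z. r * indicator {..L} z :: real)" "integrable M (\<lambda>z. s * indicator {L<..} z :: real)"
    by (auto simp: emeasure_eq_measure)
  have "\<bar>mean_gain \<phi> v - mean_gain \<psi> v\<bar> \<le> (\<integral>z. r * indicator {..L} z + s * indicator {L<..} z \<partial>M)"
    unfolding mean_gain_def
    by (intro abs_integral_diff_le integrable_gain Bochner_Integration.integrable_add int assms)
      (use assms in \<open>auto simp: zero_ext_def indicator_def\<close>)
  also have "\<dots> = r * cdf M L + s * (1 - cdf M L)"
    by (subst Bochner_Integration.integral_add[OF int]) (simp add: cdf_def measure_greaterThan[unfolded cdf_def])
  finally show ?thesis .
qed

lemma set_integral_loss:
  assumes "AE x in M. 0 \<le> x" "\<phi> \<in> H"
  shows "(LINT z:{0..v}|M. \<phi> (v - z)) = mean_loss \<phi> v"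
proof -
  note [measurable] = zero_ext_measurable[OF assms(2)]
  have "(LINT z:{0..v}|M. \<phi> (v - z)) = (\<integral>z. indicator {0..} z * zero_ext \<phi> (v - z) \<partial>M)"
    unfolding set_lebesgue_integral_def
    by (intro Bochner_Integration.integral_cong) (auto simp: indicator_def zero_ext_def)
  also have "\<dots> = mean_loss \<phi> v"
    unfolding mean_loss_def using assms(1) by (intro integral_cong_AE) auto
  finally show ?thesis .
qed

lemma set_integral_gain:
  assumes "AE x in M. 0 \<le> x" "\<phi> \<in> H" "0 \<le> v"
  shows "(LINT z:{0..}|M. \<phi> (v + z)) = mean_gain \<phi> v"
proof -
  note [measurable] = zero_ext_measurable[OF assms(2)]
  have "(LINT z:{0..}|M. \<phi> (v + z)) = (\<integral>z. indicator {0..} z * zero_ext \<phi> (v + z) \<partial>M)"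
    unfolding set_lebesgue_integral_def
    by (intro Bochner_Integration.integral_cong) (use assms in \<open>auto simp: indicator_def zero_ext_def\<close>)
  also have "\<dots> = mean_gain \<phi> v"
    unfolding mean_gain_def using assms(1) by (intro integral_cong_AE) auto
  finally show ?thesis .
qed

end

section \<open>The abstract survival operator \<open>avg\<close>\<close>

text \<open>
  \<open>M1\<close> and \<open>M2\<close> are the laws of the next jump time on the events that this jump is a claim
  and a premium, respectively; \<open>V u t\<close> is the reserve just before a jump at time \<open>t\<close>.
\<close>

locale survival_operator =
  F: real_distribution MF + G: real_distribution MG
  for MF MG :: "real measure" +
  fixes M1 M2 :: "real measure" and V :: "real \<Rightarrow> real \<Rightarrow> real"
  assumes sets_M1 [measurable_cong]: "sets M1 = sets borel"
    and sets_M2 [measurable_cong]: "sets M2 = sets borel"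
    and M1_nonzero: "emeasure M1 UNIV \<noteq> 0"
    and M2_nonzero: "emeasure M2 UNIV \<noteq> 0"
    and mass_le_1: "emeasure M1 UNIV + emeasure M2 UNIV \<le> 1"
    and V_measurable: "0 \<le> u \<Longrightarrow> V u \<in> borel_measurable borel"
    and V_nonneg: "0 \<le> u \<Longrightarrow> 0 \<le> V u t"
    and V_mono: "0 \<le> u \<Longrightarrow> u \<le> v \<Longrightarrow> V u t \<le> V v t"
begin

lemma space_M1 [simp]: "space M1 = UNIV" and space_M2 [simp]: "space M2 = UNIV"
  using sets_M1 sets_M2 by (auto dest: sets_eq_imp_space_eq)

sublocale M1: finite_measure M1
proof
  have "emeasure M1 UNIV \<le> 1"
    using mass_le_1 by (rule order_trans[rotated]) simp
  then show "emeasure M1 (space M1) \<noteq> \<infinity>"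
    by (auto simp: top_unique)
qed

sublocale M2: finite_measure M2
proof
  have "emeasure M2 UNIV \<le> 1"
    using mass_le_1 by (rule order_trans[rotated]) simp
  then show "emeasure M2 (space M2) \<noteq> \<infinity>"
    by (auto simp: top_unique)
qed

definition m1 :: real where "m1 = measure M1 UNIV"
definition m2 :: real where "m2 = measure M2 UNIV"

lemma m1_pos: "0 < m1"
  using M1_nonzero by (simp add: m1_def M1.emeasure_eq_measure zero_less_measure_iff)

lemma m2_pos: "0 < m2"
  using M2_nonzero by (simp add: m2_def M2.emeasure_eq_measure zero_less_measure_iff)

lemma m1_m2_le_1: "m1 + m2 \<le> 1"
  using mass_le_1
  by (simp add: m1_def m2_def M1.emeasure_eq_measure M2.emeasure_eq_measure
      ennreal_plus[symmetric] del: ennreal_plus)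

definition avg :: "(real \<Rightarrow> real) \<Rightarrow> real \<Rightarrow> real" where
  "avg \<phi> u = (\<integral>t. F.mean_loss \<phi> (V u t) \<partial>M1) + (\<integral>t. G.mean_gain \<phi> (V u t) \<partial>M2)"

text \<open>Members of \<open>H\<close> are controlled only on the nonnegative axis; since
  \<open>V u\<close> never leaves it, measurability can be taken from
  \<open>zero_ext\<close>.\<close>

lemma H_comp_V_measurable:
  assumes "\<theta> \<in> H" "0 \<le> u"
  shows "(\<lambda>t. \<theta> (V u t)) \<in> borel_measurable borel"
proof -
  note [measurable] = zero_ext_measurable[OF assms(1)] V_measurable[OF assms(2)]
  have "(\<lambda>t. zero_ext \<theta> (V u t)) \<in> borel_measurable borel"
    by measurable
  then show ?thesis
    using V_nonneg[OF assms(2)] by simp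
qed

lemma integrable_H_comp_V:
  assumes "\<theta> \<in> H" "0 \<le> u"
  shows "integrable M1 (\<lambda>t. \<theta> (V u t))" "integrable M2 (\<lambda>t. \<theta> (V u t))"
proof -
  note [measurable] = H_comp_V_measurable[OF assms]
  have "\<bar>\<theta> (V u t)\<bar> \<le> 1" for t
    using assms V_nonneg HD by (metis abs_of_nonneg)
  then show "integrable M1 (\<lambda>t. \<theta> (V u t))" "integrable M2 (\<lambda>t. \<theta> (V u t))"
    by (auto intro!: M1.integrable_const_bound[of _ 1] M2.integrable_const_bound[of _ 1])
qed

lemmas integrable_avg =
  integrable_H_comp_V(1)[OF F.mean_loss_in_H] integrable_H_comp_V(2)[OF G.mean_gain_in_H]

lemma avg_in_H:
  assumes "\<phi> \<in> H"
  shows "avg \<phi> \<in> H"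
proof -
  note loss = HD[OF F.mean_loss_in_H[OF assms]] and gain = HD[OF G.mean_gain_in_H[OF assms]]
  have "avg \<phi> u \<le> avg \<phi> v" if "0 \<le> u" "u \<le> v" for u v
    unfolding avg_def using that V_nonneg[of u] V_mono[of u v]
    by (intro add_mono integral_mono integrable_avg assms loss gain) auto
  moreover have "0 \<le> avg \<phi> u" if "0 \<le> u" for u
    unfolding avg_def using that V_nonneg[of u]
    by (intro add_nonneg_nonneg Bochner_Integration.integral_nonneg loss gain) auto
  moreover have "avg \<phi> u \<le> 1" if "0 \<le> u" for u
  proof -
    have "avg \<phi> u \<le> (\<integral>t. 1 \<partial>M1) + (\<integral>t. 1 \<partial>M2)"
      unfolding avg_def using that V_nonneg[of u]
      by (intro add_mono integral_mono integrable_avg assms loss gain) auto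
    then show ?thesis
      using m1_m2_le_1 by (simp add: m1_def m2_def)
  qed
  ultimately show ?thesis
    by (auto simp: H_def mono_on_def)
qed

lemma avg_le:
  assumes "\<phi> \<in> H" "\<psi> \<in> H" "\<And>u. 0 \<le> u \<Longrightarrow> \<phi> u \<le> \<psi> u" "0 \<le> u"
  shows "avg \<phi> u \<le> avg \<psi> u"
  unfolding avg_def
  by (intro add_mono integral_mono integrable_avg F.mean_loss_le G.mean_gain_le assms)

text \<open>The second point \<open>v\<close> makes the claim term uniform in the start:
  \<open>V u t \<le> V v t\<close> gives the same bound for all \<open>u\<close> in
  \<open>[0, v]\<close>. Later \<open>v\<close> is \<open>u\<close> itself or the threshold
  \<open>L\<close>.\<close>

lemma avg_diff_le:
  assumes "\<phi> \<in> H" "\<psi> \<in> H" "0 \<le> u" "u \<le> v"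
    and r: "\<And>u. 0 \<le> u \<Longrightarrow> \<bar>\<phi> u - \<psi> u\<bar> \<le> r" "0 \<le> r"
    and s: "\<And>u. L \<le> u \<Longrightarrow> \<bar>\<phi> u - \<psi> u\<bar> \<le> s" and "0 \<le> L"
  shows "\<bar>avg \<phi> u - avg \<psi> u\<bar> \<le>
    r * (\<integral>t. cdf MF (V v t) \<partial>M1) + (r * cdf MG L + s * (1 - cdf MG L)) * m2"
proof -
  have int: "integrable M1 (\<lambda>t. cdf MF (V v t))"
    using assms by (intro integrable_H_comp_V F.cdf_in_H) auto
  have "\<bar>F.mean_loss \<phi> (V u t) - F.mean_loss \<psi> (V u t)\<bar> \<le> r * cdf MF (V v t)" for t
    using F.mean_loss_diff_le[OF assms(1,2) r(1), of "V u t"] V_mono[of u v t] assms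
    by (meson F.cdf_nondecreasing mult_left_mono order_trans)
  then have "\<bar>(\<integral>t. F.mean_loss \<phi> (V u t) \<partial>M1) - (\<integral>t. F.mean_loss \<psi> (V u t) \<partial>M1)\<bar>
      \<le> (\<integral>t. r * cdf MF (V v t) \<partial>M1)"
    using int by (intro abs_integral_diff_le integrable_avg assms) auto
  moreover have "\<bar>(\<integral>t. G.mean_gain \<phi> (V u t) \<partial>M2) - (\<integral>t. G.mean_gain \<psi> (V u t) \<partial>M2)\<bar>
      \<le> (\<integral>t. r * cdf MG L + s * (1 - cdf MG L) \<partial>M2)"
    using V_nonneg[OF assms(3)]
    by (intro abs_integral_diff_le integrable_avg assms G.mean_gain_diff_le M2.integrable_const) auto
  ultimately show ?thesis
    unfolding avg_def by (simp add: m2_def mult.commute)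
qed

lemma integral_cdf_V_le:
  assumes "0 \<le> u"
  shows "(\<integral>t. cdf MF (V u t) \<partial>M1) \<le> m1"
    and "\<forall>z\<ge>0. cdf MF z < 1 \<Longrightarrow> (\<integral>t. cdf MF (V u t) \<partial>M1) < m1"
proof -
  have int: "integrable M1 (\<lambda>t. cdf MF (V u t))"
    using assms by (intro integrable_H_comp_V F.cdf_in_H) auto
  have "(\<integral>t. cdf MF (V u t) \<partial>M1) \<le> (\<integral>t. 1 \<partial>M1)"
    using int by (intro integral_mono) (auto simp: F.cdf_bounded_prob)
  then show "(\<integral>t. cdf MF (V u t) \<partial>M1) \<le> m1"
    by (simp add: m1_def)
  assume "\<forall>z\<ge>0. cdf MF z < 1"
  \<comment> \<open>The pointwise strict inequality survives integration because \<open>M1\<close>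
    is not the null measure.\<close>
  then have "(\<integral>t. cdf MF (V u t) \<partial>M1) < (\<integral>t. 1 \<partial>M1)"
    using int M1_nonzero V_nonneg[OF assms] by (intro M1.integral_less_AE_space) auto
  then show "(\<integral>t. cdf MF (V u t) \<partial>M1) < m1"
    by (simp add: m1_def)
qed

section \<open>Non-expansion and contraction of \<open>avg\<close> with respect to
  \<open>rho\<close>\<close>

lemma rho_avg_le:
  assumes "\<phi> \<in> H" "\<psi> \<in> H"
  shows "rho (avg \<phi>) (avg \<psi>) \<le> rho \<phi> \<psi>"
proof (rule rho_le)
  fix u :: real assume u: "0 \<le> u"
  let ?r = "rho \<phi> \<psi>"
  have r: "0 \<le> ?r"
    by (rule rho_nonneg[OF assms])
  \<comment> \<open>Taking \<open>L = 0\<close> and \<open>s = r\<close> leaves the premium term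
    with the plain factor \<open>m2\<close>.\<close>
  have "\<bar>avg \<phi> u - avg \<psi> u\<bar> \<le>
      ?r * (\<integral>t. cdf MF (V u t) \<partial>M1) + (?r * cdf MG 0 + ?r * (1 - cdf MG 0)) * m2"
    using assms u r by (intro avg_diff_le abs_diff_le_rho) auto
  also have "\<dots> \<le> ?r * m1 + ?r * m2"
    using mult_left_mono[OF integral_cdf_V_le(1)[OF u] r] by (simp add: algebra_simps)
  also have "\<dots> \<le> ?r"
    using m1_m2_le_1 r by (metis distrib_left mult.right_neutral mult_left_mono)
  finally show "\<bar>avg \<phi> u - avg \<psi> u\<bar> \<le> ?r" .
qed

text \<open>The constant is chosen before the functions, from \<open>L\<close> and the laws alone,
  since one \<open>q\<close> must serve every step of the iteration. For unbounded claims the half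
  bound after averaging is used, for unbounded premiums the one before.\<close>

lemma rho_avg_contraction:
  assumes "0 \<le> L" and tails: "(\<forall>z\<ge>0. cdf MF z < 1) \<or> (\<forall>z\<ge>0. cdf MG z < 1)"
  shows "\<exists>q. 0 \<le> q \<and> q < 1 \<and> (\<forall>\<phi>\<in>H. \<forall>\<psi>\<in>H.
    (\<forall>u\<ge>L. \<bar>\<phi> u - \<psi> u\<bar> \<le> rho \<phi> \<psi> / 2) \<longrightarrow>
    (\<forall>u\<ge>L. \<bar>avg \<phi> u - avg \<psi> u\<bar> \<le> rho \<phi> \<psi> / 2) \<longrightarrow>
    rho (avg \<phi>) (avg \<psi>) \<le> q * rho \<phi> \<psi>)"
  using tails
proof
  assume F: "\<forall>z\<ge>0. cdf MF z < 1"
  \<comment> \<open>\<open>1/2\<close> covers \<open>u \<ge> L\<close>, where the tail bound holds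
    already; the other entry is the factor on \<open>[0, L]\<close>, where ruin removes mass from
    the claim term.\<close>
  define q where "q = max (1/2) ((\<integral>t. cdf MF (V L t) \<partial>M1) + m2)"
  have "q < 1"
    using integral_cdf_V_le(2)[OF assms(1) F] m1_m2_le_1 by (simp add: q_def)
  moreover have "rho (avg \<phi>) (avg \<psi>) \<le> q * rho \<phi> \<psi>"
    if H: "\<phi> \<in> H" "\<psi> \<in> H" and tail: "\<forall>u\<ge>L. \<bar>avg \<phi> u - avg \<psi> u\<bar> \<le> rho \<phi> \<psi> / 2" for \<phi> \<psi>
  proof (rule rho_le)
    fix u :: real assume u: "0 \<le> u"
    let ?r = "rho \<phi> \<psi>"
    have r: "0 \<le> ?r"
      by (rule rho_nonneg[OF H])
    show "\<bar>avg \<phi> u - avg \<psi> u\<bar> \<le> q * ?r"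
    proof (cases "L \<le> u")
      case True
      then have "\<bar>avg \<phi> u - avg \<psi> u\<bar> \<le> 1/2 * ?r"
        using tail by simp
      also have "\<dots> \<le> q * ?r"
        using r by (intro mult_right_mono) (auto simp: q_def)
      finally show ?thesis .
    next
      case False
      have "\<bar>avg \<phi> u - avg \<psi> u\<bar> \<le>
          ?r * (\<integral>t. cdf MF (V L t) \<partial>M1) + (?r * cdf MG L + ?r * (1 - cdf MG L)) * m2"
        using H u r assms(1) False by (intro avg_diff_le abs_diff_le_rho) auto
      also have "\<dots> = ((\<integral>t. cdf MF (V L t) \<partial>M1) + m2) * ?r"
        by (simp add: algebra_simps)
      also have "\<dots> \<le> q * ?r"
        using r by (intro mult_right_mono) (auto simp: q_def)
      finally show ?thesis .
    qed
  qed
  moreover have "0 \<le> q"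
    by (simp add: q_def)
  ultimately show ?thesis
    by blast
next
  assume G: "\<forall>z\<ge>0. cdf MG z < 1"
  \<comment> \<open>A premium above \<open>L\<close> has weight \<open>(1 - cdf MG L) * m2\<close>,
    and on that event half of the distance is saved.\<close>
  define \<delta> where "\<delta> = (1 - cdf MG L) * m2 / 2"
  have \<delta>: "0 < \<delta>" "\<delta> \<le> 1"
  proof -
    show "0 < \<delta>"
      using G assms(1) m2_pos by (simp add: \<delta>_def)
    have "(1 - cdf MG L) * m2 \<le> 1 * 1"
      using m1_m2_le_1 m1_pos m2_pos G.cdf_nonneg[of L] by (intro mult_mono) auto
    then show "\<delta> \<le> 1"
      by (simp add: \<delta>_def)
  qed
  have "rho (avg \<phi>) (avg \<psi>) \<le> (1 - \<delta>) * rho \<phi> \<psi>"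
    if H: "\<phi> \<in> H" "\<psi> \<in> H" and tail: "\<forall>u\<ge>L. \<bar>\<phi> u - \<psi> u\<bar> \<le> rho \<phi> \<psi> / 2" for \<phi> \<psi>
  proof (rule rho_le)
    fix u :: real assume u: "0 \<le> u"
    let ?r = "rho \<phi> \<psi>"
    have r: "0 \<le> ?r"
      by (rule rho_nonneg[OF H])
    have "\<bar>avg \<phi> u - avg \<psi> u\<bar> \<le>
        ?r * (\<integral>t. cdf MF (V u t) \<partial>M1) + (?r * cdf MG L + ?r / 2 * (1 - cdf MG L)) * m2"
      using H u r assms(1) tail by (intro avg_diff_le abs_diff_le_rho) auto
    also have "\<dots> \<le> ?r * m1 + (?r * cdf MG L + ?r / 2 * (1 - cdf MG L)) * m2"
      using integral_cdf_V_le(1)[OF u] r by (simp add: mult_left_mono)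
    also have "\<dots> = ?r * (m1 + m2) - \<delta> * ?r"
      by (simp add: \<delta>_def field_simps)
    also have "\<dots> \<le> ?r * 1 - \<delta> * ?r"
      using m1_m2_le_1 r by (intro diff_right_mono mult_left_mono)
    finally show "\<bar>avg \<phi> u - avg \<psi> u\<bar> \<le> (1 - \<delta>) * ?r"
      by (simp add: algebra_simps)
  qed
  then show ?thesis
    using \<delta> by (intro exI[of _ "1 - \<delta>"]) auto
qed

section \<open>Convergence of the iterates of \<open>avg\<close>\<close>

theorem iteration_converges:
  assumes tails: "(\<forall>z\<ge>0. cdf MF z < 1) \<or> (\<forall>z\<ge>0. cdf MG z < 1)"
    and low: "\<phi>low \<in> H" "\<And>u. 0 \<le> u \<Longrightarrow> \<phi>low u \<le> avg \<phi>low u" "(\<phi>low \<longlongrightarrow> 1) at_top"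
    and seq_0: "\<phi>seq 0 \<in> H" "\<And>u. 0 \<le> u \<Longrightarrow> \<phi>low u \<le> \<phi>seq 0 u"
    and seq_Suc: "\<And>k u. \<phi>seq k \<in> H \<Longrightarrow> 0 \<le> u \<Longrightarrow> \<phi>seq (Suc k) u = avg (\<phi>seq k) u"
    and \<phi>: "\<phi> \<in> H" "\<And>u. 0 \<le> u \<Longrightarrow> \<phi> u = avg \<phi> u" "(\<phi> \<longlongrightarrow> 1) at_top"
  shows "decseq (\<lambda>k. rho (\<phi>seq k) \<phi>)"
    and "(\<lambda>k. rho (\<phi>seq k) \<phi>) \<longlonglongrightarrow> 0"
    and "\<And>\<epsilon>. 0 < \<epsilon> \<Longrightarrow> \<exists>q\<in>{0..<1}. \<forall>k. \<epsilon> \<le> rho (\<phi>seq k) \<phi> \<longrightarrow>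
      rho (\<phi>seq k) \<phi> \<le> q ^ k * rho (\<phi>seq 0) \<phi>"
proof -
  define r where "r k = rho (\<phi>seq k) \<phi>" for k
  \<comment> \<open>Membership and barrier go together: the recursion is available only once
    \<open>\<phi>seq k \<in> H\<close>, and then
    \<open>\<phi>low \<le> avg \<phi>low \<le> avg (\<phi>seq k)\<close> passes the barrier
    on.\<close>
  have seq: "\<phi>seq k \<in> H \<and> (\<forall>u\<ge>0. \<phi>low u \<le> \<phi>seq k u)" for k
  proof (induction k)
    case 0
    show ?case using seq_0 by simp
  next
    case (Suc k)
    then have "\<phi>seq (Suc k) \<in> H"
      using avg_in_H[of "\<phi>seq k"] seq_Suc[of k] by (auto simp: H_def mono_on_def)
    moreover have "\<phi>low u \<le> \<phi>seq (Suc k) u" if "0 \<le> u" for u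
      using low(2)[OF that] avg_le[of \<phi>low "\<phi>seq k" u] Suc low(1) that seq_Suc[of k] by force
    ultimately show ?case by simp
  qed
  have r_nonneg: "0 \<le> r k" for k
    using seq \<phi> by (simp add: r_def rho_nonneg)
  \<comment> \<open>The iterates are tied to \<open>avg\<close> only at nonnegative arguments, so
    the distances are equated, not the functions.\<close>
  have rho_Suc: "r (Suc k) = rho (avg (\<phi>seq k)) (avg \<phi>)" for k
    unfolding r_def rho_def using seq seq_Suc \<phi>(2) by (intro SUP_cong) auto
  show dec: "decseq (\<lambda>k. rho (\<phi>seq k) \<phi>)"
    unfolding r_def[symmetric] by (rule decseq_SucI) (use rho_Suc rho_avg_le seq \<phi> in \<open>auto simp: r_def\<close>)
  have geometric: "\<exists>q\<in>{0..<1}. \<forall>k. \<epsilon> \<le> r k \<longrightarrow> r k \<le> q ^ k * r 0" if \<epsilon>: "0 < \<epsilon>" for \<epsilon>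
  proof -
    \<comment> \<open>Beyond \<open>L\<close> the barrier, hence every iterate, and the solution lie
      in \<open>(1 - \<epsilon>/2, 1]\<close>, so one \<open>L\<close> serves all
      \<open>k\<close>.\<close>
    have "eventually (\<lambda>u. 0 \<le> u \<and> 1 - \<epsilon> / 2 < \<phi>low u \<and> 1 - \<epsilon> / 2 < \<phi> u) at_top"
      using low(3) \<phi>(3) \<epsilon> by (intro eventually_conj eventually_ge_at_top order_tendstoD(1)) auto
    then obtain L where L: "\<And>u. L \<le> u \<Longrightarrow> 0 \<le> u \<and> 1 - \<epsilon> / 2 < \<phi>low u \<and> 1 - \<epsilon> / 2 < \<phi> u"
      by (auto simp: eventually_at_top_linorder)
    have tail: "\<bar>\<phi>seq k u - \<phi> u\<bar> \<le> \<epsilon> / 2" if "L \<le> u" for k u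
    proof -
      have "0 \<le> u" using L[OF that] by simp
      then have "\<phi>low u \<le> \<phi>seq k u" "\<phi>seq k u \<le> 1" "\<phi> u \<le> 1"
        using seq[of k] \<phi>(1) H_le_1 by auto
      then show ?thesis
        using L[OF that] by linarith
    qed
    obtain q where q: "0 \<le> q" "q < 1" and contraction: "\<And>\<theta> \<psi>. \<theta> \<in> H \<Longrightarrow> \<psi> \<in> H \<Longrightarrow>
        \<forall>u\<ge>L. \<bar>\<theta> u - \<psi> u\<bar> \<le> rho \<theta> \<psi> / 2 \<Longrightarrow>
        \<forall>u\<ge>L. \<bar>avg \<theta> u - avg \<psi> u\<bar> \<le> rho \<theta> \<psi> / 2 \<Longrightarrow>
        rho (avg \<theta>) (avg \<psi>) \<le> q * rho \<theta> \<psi>"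
      using rho_avg_contraction[OF _ tails, of L] L[of L] by blast
    \<comment> \<open>\<open>\<epsilon> \<le> r k\<close> turns the tail bound
      \<open>\<epsilon>/2\<close> into \<open>r k / 2\<close>, for the current pair and, as
      \<open>avg\<close> fixes the solution, for the next one.\<close>
    have step: "r (Suc k) \<le> q * r k" if "\<epsilon> \<le> r k" for k
      unfolding rho_Suc unfolding r_def
    proof (intro contraction allI impI)
      fix u assume u: "L \<le> u"
      show "\<bar>\<phi>seq k u - \<phi> u\<bar> \<le> rho (\<phi>seq k) \<phi> / 2"
        using tail[OF u, of k] that by (simp add: r_def)
      have "avg (\<phi>seq k) u = \<phi>seq (Suc k) u" "avg \<phi> u = \<phi> u"
        using seq[of k] seq_Suc[of k u] \<phi>(2)[of u] L[OF u] by auto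
      then show "\<bar>avg (\<phi>seq k) u - avg \<phi> u\<bar> \<le> rho (\<phi>seq k) \<phi> / 2"
        using tail[OF u, of "Suc k"] that by (simp add: r_def)
    qed (use seq \<phi> in auto)
    have "r k \<le> q ^ k * r 0" if "\<epsilon> \<le> r k" for k
      using that
    proof (induction k)
      case (Suc k)
      \<comment> \<open>The distances decrease, so one that is still at least
        \<open>\<epsilon>\<close> forces all earlier ones to be so, and every step so far has
        contracted.\<close>
      have "\<epsilon> \<le> r k"
        using Suc.prems decseq_SucD[OF dec, of k] by (simp add: r_def)
      then have "r (Suc k) \<le> q * r k" "r k \<le> q ^ k * r 0"
        using step Suc.IH by auto
      then show ?case
        using q by (metis mult.assoc mult_left_mono order_trans power_Suc)
    qed simp
    then show ?thesis
      using q by (intro bexI[of _ q]) auto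
  qed
  then show "\<exists>q\<in>{0..<1}. \<forall>k. \<epsilon> \<le> rho (\<phi>seq k) \<phi> \<longrightarrow>
      rho (\<phi>seq k) \<phi> \<le> q ^ k * rho (\<phi>seq 0) \<phi>" if "0 < \<epsilon>" for \<epsilon>
    using that by (simp add: r_def)
  have "r \<longlonglongrightarrow> 0"
  proof (rule decreasing_tendsto)
    show "\<forall>\<^sub>F k in sequentially. 0 \<le> r k"
      using r_nonneg by simp
    fix \<epsilon> :: real assume \<epsilon>: "0 < \<epsilon>"
    obtain q where q: "0 \<le> q" "q < 1" and bound: "\<And>k. \<epsilon> \<le> r k \<Longrightarrow> r k \<le> q ^ k * r 0"
      using geometric[OF \<epsilon>] by auto
    have "(\<lambda>k. q ^ k * r 0) \<longlonglongrightarrow> 0 * r 0"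
      using q by (intro tendsto_mult LIMSEQ_power_zero tendsto_const) auto
    then have "\<forall>\<^sub>F k in sequentially. q ^ k * r 0 < \<epsilon>"
      using \<epsilon> by (intro order_tendstoD) auto
    \<comment> \<open>Otherwise \<open>\<epsilon> \<le> r k \<le> q ^ k * r 0\<close>, against the
      choice of \<open>k\<close>.\<close>
    then show "\<forall>\<^sub>F k in sequentially. r k < \<epsilon>"
    proof eventually_elim
      case (elim k)
      then show ?case
        using bound[of k] by linarith
    qed
  qed
  then show "(\<lambda>k. rho (\<phi>seq k) \<phi>) \<longlonglongrightarrow> 0"
    by (simp add: r_def[abs_def])
qed

end

section \<open>\<open>A1\<close> and \<open>A2\<close> as instances of the abstract operator\<close>

lemma survival_operator_A1:
  assumes "0 < \<alpha>c" "0 < \<alpha>p"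
    and MF: "real_distribution MF" "AE x in MF. 0 \<le> x"
    and MG: "real_distribution MG" "AE x in MG. 0 \<le> x"
  obtains M1 M2 V where "survival_operator MF MG M1 M2 V"
    "\<And>\<phi> u. \<phi> \<in> H \<Longrightarrow> 0 \<le> u \<Longrightarrow>
      A1 \<alpha>c \<alpha>p (cdf MF) (cdf MG) \<phi> u = survival_operator.avg MF MG M1 M2 V \<phi> u"
proof -
  interpret F: real_distribution MF by fact
  interpret G: real_distribution MG by fact
  define p1 p2 where "p1 = \<alpha>c / (\<alpha>c + \<alpha>p)" and "p2 = \<alpha>p / (\<alpha>c + \<alpha>p)"
  \<comment> \<open>No waiting time enters \<open>A1\<close>, so the jump is placed at time
    \<open>0\<close>: a point mass scaled by \<open>p\<close>, with unchanged reserve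
    \<open>V u t = u\<close>.\<close>
  define M :: "real \<Rightarrow> real measure" where "M p = density (return borel 0) (\<lambda>_. ennreal p)" for p
  have p: "0 < p1" "0 < p2" "p1 + p2 = 1"
    using assms by (auto simp: p1_def p2_def add_divide_distrib[symmetric])
  have M: "emeasure (M p) UNIV = ennreal p" for p
    by (simp add: M_def emeasure_density)
  interpret survival_operator MF MG "M p1" "M p2" "\<lambda>u t. u"
  proof
    show "emeasure (M p1) UNIV + emeasure (M p2) UNIV \<le> 1"
      using p by (simp add: M ennreal_plus[symmetric] del: ennreal_plus)
  qed (use p in \<open>simp_all add: M, simp_all add: M_def\<close>)
  have int: "(\<integral>t. x \<partial>M p) = p * x" if "0 \<le> p" for p x :: real
  proof -
    have "space (M p) = UNIV"
      by (simp add: M_def)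
    then show ?thesis
      using that by (simp add: measure_def M)
  qed
  have "A1 \<alpha>c \<alpha>p (cdf MF) (cdf MG) \<phi> u = avg \<phi> u" if "\<phi> \<in> H" "0 \<le> u" for \<phi> u
    unfolding A1_def p1_def[symmetric] p2_def[symmetric] avg_def interval_measure_cdf[OF MF(1)] interval_measure_cdf[OF MG(1)]
      F.set_integral_loss[OF MF(2) that(1)] G.set_integral_gain[OF MG(2) that]
      int[OF less_imp_le[OF p(1)]] int[OF less_imp_le[OF p(2)]] ..
  then show thesis
    using survival_operator_axioms that by blast
qed

text \<open>Two independent clocks compete: \<open>M1\<close> is \<open>(1 - Kp) dKc\<close> and
  \<open>M2\<close> is \<open>(1 - Kc) dKp\<close>. The events that one rings strictly before the
  other are disjoint, so the masses add up to at most \<open>1\<close>.\<close>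

lemma survival_operator_A2:
  assumes MF: "real_distribution MF" "AE x in MF. 0 \<le> x"
    and MG: "real_distribution MG" "AE x in MG. 0 \<le> x"
    and Mp: "real_distribution Mp" "AE x in Mp. 0 \<le> x" "\<forall>t\<ge>0. cdf Mp t < 1"
    and Mc: "real_distribution Mc" "AE x in Mc. 0 \<le> x" "\<forall>t\<ge>0. cdf Mc t < 1"
    and U_cont: "\<And>u. 0 \<le> u \<Longrightarrow> continuous_on {0..} (U u)"
    and U_nonneg: "\<And>u t. 0 \<le> u \<Longrightarrow> 0 \<le> t \<Longrightarrow> 0 \<le> U u t"
    and U_mono: "\<And>t. 0 \<le> t \<Longrightarrow> mono_on {0..} (\<lambda>u. U u t)"
  obtains M1 M2 V where "survival_operator MF MG M1 M2 V"
    "\<And>\<phi> u. \<phi> \<in> H \<Longrightarrow> 0 \<le> u \<Longrightarrow>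
      A2 (cdf MF) (cdf MG) U (cdf Mp) (cdf Mc) \<phi> u = survival_operator.avg MF MG M1 M2 V \<phi> u"
proof -
  interpret F: real_distribution MF by fact
  interpret G: real_distribution MG by fact
  interpret p: real_distribution Mp by fact
  interpret c: real_distribution Mc by fact
  \<comment> \<open>With independent \<open>X\<close> of law \<open>M\<close> and \<open>Y\<close>
    of law \<open>N\<close>, this is the law of \<open>X\<close> on the event
    \<open>X < Y\<close>.\<close>
  define D where "D M N = density M (\<lambda>t. ennreal (1 - cdf N t))" for M N
  \<comment> \<open>The locale wants a path for every real time; freezing it at time
    \<open>0\<close> for negative \<open>t\<close> keeps it continuous, nonnegative and monotone in
    \<open>u\<close>.\<close>
  define V where "V u t = U u (max 0 t)" for u t
  have D: "emeasure (D M N) UNIV = (\<integral>\<^sup>+t. ennreal (1 - cdf N t) \<partial>M)"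
    and D_nonzero: "AE x in M. 0 \<le> x \<Longrightarrow> \<forall>t\<ge>0. cdf N t < 1 \<Longrightarrow> emeasure (D M N) UNIV \<noteq> 0"
    if MN: "real_distribution M" "real_distribution N" for M N
  proof -
    interpret M: real_distribution M by fact
    interpret N: real_distribution N by fact
    show D: "emeasure (D M N) UNIV = (\<integral>\<^sup>+t. ennreal (1 - cdf N t) \<partial>M)"
      by (simp add: D_def emeasure_density)
    assume nonneg: "AE x in M. 0 \<le> x" and less: "\<forall>t\<ge>0. cdf N t < 1"
    show "emeasure (D M N) UNIV \<noteq> 0"
    proof
      assume "emeasure (D M N) UNIV = 0"
      \<comment> \<open>Zero mass would force \<open>cdf N t = 1\<close> for almost every
        \<open>t\<close>, yet almost every \<open>t\<close> is nonnegative.\<close>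
      then have "AE t in M. ennreal (1 - cdf N t) = 0"
        unfolding D by (subst (asm) nn_integral_0_iff_AE) auto
      with nonneg have "AE t in M. False"
        by eventually_elim (use less in \<open>force simp: ennreal_eq_0_iff\<close>)
      then show False by simp
    qed
  qed
  have V_meas: "V u \<in> borel_measurable borel" if "0 \<le> u" for u
  proof -
    have "continuous_on UNIV (\<lambda>t. U u (max 0 t))"
      by (rule continuous_on_compose2[OF U_cont[OF that]]) (auto intro!: continuous_on_max continuous_on_id)
    then show ?thesis
      unfolding V_def by (rule borel_measurable_continuous_onI)
  qed
  interpret survival_operator MF MG "D Mc Mp" "D Mp Mc" V
  proof
    show "emeasure (D Mc Mp) UNIV + emeasure (D Mp Mc) UNIV \<le> 1"
      using nn_integral_cdf_swap_le_1[OF Mp(1) Mc(1)] Mp(1) Mc(1) by (simp add: D)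
  next
    fix u v t :: real assume "0 \<le> u" "u \<le> v"
    then show "V u t \<le> V v t"
      using U_mono[of "max 0 t"] by (auto simp: V_def mono_on_def)
  qed (use V_meas U_nonneg D_nonzero Mp Mc in \<open>auto simp: D_def V_def\<close>)
  \<comment> \<open>Both summands of \<open>A2\<close> have this shape, with \<open>f\<close> the
    inner integral and \<open>\<theta>\<close> the corresponding mean; agreement at nonnegative
    reserves suffices.\<close>
  have set_int: "(LINT t:{0..}|M. f (U u t) * (1 - cdf N t)) = (\<integral>t. \<theta> (V u t) \<partial>D M N)"
    if MN: "real_distribution M" "AE t in M. 0 \<le> t" "real_distribution N"
      and \<theta>: "\<theta> \<in> H" and u: "0 \<le> u" and eq: "\<And>v. 0 \<le> v \<Longrightarrow> f v = \<theta> v" for M N f \<theta> u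
  proof -
    interpret M: real_distribution M by fact
    interpret N: real_distribution N by fact
    note [measurable] = H_comp_V_measurable[OF \<theta> u]
    have "(LINT t:{0..}|M. f (U u t) * (1 - cdf N t)) =
        (\<integral>t. indicator {0..} t * ((1 - cdf N t) * \<theta> (V u t)) \<partial>M)"
      unfolding set_lebesgue_integral_def using U_nonneg[OF u]
      by (intro Bochner_Integration.integral_cong) (auto simp: indicator_def V_def eq)
    also have "\<dots> = (\<integral>t. (1 - cdf N t) * \<theta> (V u t) \<partial>M)"
      using MN(2) by (intro integral_cong_AE) auto
    also have "\<dots> = (\<integral>t. \<theta> (V u t) \<partial>D M N)"
      unfolding D_def by (subst integral_density) (auto simp: N.cdf_bounded_prob)
    finally show ?thesis .
  qed
  have "A2 (cdf MF) (cdf MG) U (cdf Mp) (cdf Mc) \<phi> u = avg \<phi> u" if "\<phi> \<in> H" "0 \<le> u" for \<phi> u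
  proof -
    have "(LINT t:{0..}|Mc. (LINT z:{0..U u t}|MF. \<phi> (U u t - z)) * (1 - cdf Mp t)) =
        (\<integral>t. F.mean_loss \<phi> (V u t) \<partial>D Mc Mp)"
      by (rule set_int[OF Mc(1,2) Mp(1) F.mean_loss_in_H[OF that(1)] that(2)])
        (rule F.set_integral_loss[OF MF(2) that(1)])
    moreover have "(LINT t:{0..}|Mp. (LINT z:{0..}|MG. \<phi> (U u t + z)) * (1 - cdf Mc t)) =
        (\<integral>t. G.mean_gain \<phi> (V u t) \<partial>D Mp Mc)"
      by (rule set_int[OF Mp(1,2) Mc(1) G.mean_gain_in_H[OF that(1)] that(2)])
        (rule G.set_integral_gain[OF MG(2) that(1)])
    ultimately show ?thesis
      by (simp add: A2_def avg_def interval_measure_cdf MF(1) MG(1) Mp(1) Mc(1))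
  qed
  then show thesis
    using survival_operator_axioms that by blast
qed

section \<open>Transfer of the convergence result to \<open>A\<close>\<close>

theorem theorem6p5:
  fixes \<alpha>c \<alpha>p :: real
    and F G Kp Kc c :: "real \<Rightarrow> real"
    and U :: "real \<Rightarrow> real \<Rightarrow> real"
    and A :: "(real \<Rightarrow> real) \<Rightarrow> real \<Rightarrow> real"
    and \<phi>low \<phi>upp \<phi> :: "real \<Rightarrow> real"
    and \<phi>seq :: "nat \<Rightarrow> real \<Rightarrow> real"
  assumes "\<alpha>c > 0" and "\<alpha>p > 0"
    and "nonneg_distribution_function F" and "nonneg_distribution_function G"
    and "\<forall>x\<ge>0. 0 \<le> c x" and "piecewise_continuous_nonneg c"
    and "\<forall>u\<ge>0. cauchy_solution c u (U u)"
    and "\<forall>t\<ge>0. mono_on {0..} (\<lambda>u. U u t)"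
    and "nonneg_distribution_function Kp" and "nonneg_distribution_function Kc"
    and "\<forall>t. \<not> (\<not> isCont Kp t \<and> \<not> isCont Kc t)"
    and "\<forall>t\<ge>0. Kp t < 1" and "\<forall>t\<ge>0. Kc t < 1"
    and "A \<in> {A1 \<alpha>c \<alpha>p F G, A2 F G U Kp Kc}"
    and "\<phi>low \<in> H" and "\<phi>upp \<in> H"
    and "\<forall>u\<ge>0. \<phi>low u \<le> \<phi>upp u"
    and "\<forall>u\<ge>0. A \<phi>upp u \<le> \<phi>upp u"
    and "\<forall>u\<ge>0. A \<phi>low u \<ge> \<phi>low u"
    and "(\<phi>low \<longlongrightarrow> 1) at_top" and "(\<phi>upp \<longlongrightarrow> 1) at_top"
    and "(\<forall>z\<ge>0. F z < 1) \<or> (\<forall>z\<ge>0. G z < 1)"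
    and "\<phi>seq 0 \<in> H"
    and "\<forall>u\<ge>0. \<phi>low u \<le> \<phi>seq 0 u \<and> \<phi>seq 0 u \<le> \<phi>upp u"
    and "\<forall>k. \<forall>u\<ge>0. \<phi>seq (Suc k) u = A (\<phi>seq k) u"
    and "\<phi> \<in> H" and "\<forall>u\<ge>0. \<phi> u = A \<phi> u" and "(\<phi> \<longlongrightarrow> 1) at_top"
  shows "decseq (\<lambda>k. rho (\<phi>seq k) \<phi>) \<and>
         (\<lambda>k. rho (\<phi>seq k) \<phi>) \<longlonglongrightarrow> 0 \<and>
         (\<forall>\<epsilon>>0. \<exists>q\<in>{0..<1::real}. \<forall>k. rho (\<phi>seq k) \<phi> \<ge> \<epsilon> \<longrightarrow>
             rho (\<phi>seq k) \<phi> \<le> q ^ k * rho (\<phi>seq 0) \<phi>)"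
proof -
  obtain MF where MF: "real_distribution MF" "AE x in MF. 0 \<le> x" "F = cdf MF"
    using assms(3) by (auto simp: nonneg_distribution_function_def)
  obtain MG where MG: "real_distribution MG" "AE x in MG. 0 \<le> x" "G = cdf MG"
    using assms(4) by (auto simp: nonneg_distribution_function_def)
  obtain Mp where Mp: "real_distribution Mp" "AE x in Mp. 0 \<le> x" "Kp = cdf Mp"
    using assms(9) by (auto simp: nonneg_distribution_function_def)
  obtain Mc where Mc: "real_distribution Mc" "AE x in Mc. 0 \<le> x" "Kc = cdf Mc"
    using assms(10) by (auto simp: nonneg_distribution_function_def)
  \<comment> \<open>Either choice of \<open>A\<close> agrees on \<open>H\<close> with
    \<open>avg\<close> of some instance, so the two cases merge from here on.\<close>
  obtain M1 M2 V where op: "survival_operator MF MG M1 M2 V"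
    and A_eq: "\<And>\<phi> u. \<phi> \<in> H \<Longrightarrow> 0 \<le> u \<Longrightarrow> A \<phi> u = survival_operator.avg MF MG M1 M2 V \<phi> u"
  proof (cases "A = A1 \<alpha>c \<alpha>p F G")
    case True
    show thesis
      by (rule survival_operator_A1[OF assms(1,2) MF(1,2) MG(1,2)])
        (use that True MF(3) MG(3) in blast)
  next
    case False
    then have A: "A = A2 F G U Kp Kc"
      using assms(14) by blast
    have U: "continuous_on {0..} (U u)" "0 \<le> t \<Longrightarrow> 0 \<le> U u t" if "0 \<le> u" for u t
      using assms(7) that by (auto simp: cauchy_solution_def)
    show thesis
      by (rule survival_operator_A2[OF MF(1,2) MG(1,2) Mp(1,2) _ Mc(1,2), where U = U])
        (use that A MF(3) MG(3) Mp(3) Mc(3) assms(8,12,13) U in blast)+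
  qed
  interpret survival_operator MF MG M1 M2 V
    by (rule op)
  show ?thesis
  proof (intro conjI allI impI)
    have tails: "(\<forall>z\<ge>0. cdf MF z < 1) \<or> (\<forall>z\<ge>0. cdf MG z < 1)"
      using assms(22) MF(3) MG(3) by simp
    have low: "\<phi>low u \<le> avg \<phi>low u" "\<phi>low u \<le> \<phi>seq 0 u" if "0 \<le> u" for u
      using assms(15,19,24) A_eq that by auto
    have seq: "\<phi>seq (Suc k) u = avg (\<phi>seq k) u" if "\<phi>seq k \<in> H" "0 \<le> u" for k u
      using assms(25) A_eq that by auto
    have sol: "\<phi> u = avg \<phi> u" if "0 \<le> u" for u
      using assms(26,27) A_eq that by metis
    note conv = iteration_converges[where \<phi>seq = \<phi>seq,
        OF tails assms(15) low(1) assms(20,23) low(2) seq assms(26) sol assms(28)]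
    show "decseq (\<lambda>k. rho (\<phi>seq k) \<phi>)" "(\<lambda>k. rho (\<phi>seq k) \<phi>) \<longlonglongrightarrow> 0"
      by (rule conv; assumption)+
    show "\<exists>q\<in>{0..<1}. \<forall>k. \<epsilon> \<le> rho (\<phi>seq k) \<phi> \<longrightarrow> rho (\<phi>seq k) \<phi> \<le> q ^ k * rho (\<phi>seq 0) \<phi>"
      if "0 < \<epsilon>" for \<epsilon>
      by (rule conv(3)[OF _ _ _ _ _ that])
  qed
qed

end
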